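(* Let $D=(d_1,d_2,\ldots,d_n)$ be a non-negative and non-increasing integer sequence. Then $D$ is a forcibly unicyclic graphic sequence if and only if one of the following holds: (1) $D=(2^5)$ or $D=(3,2^4,1)$; (2) $D=(n-2,2^3,1^{n-4})$, where $n\ge 4$; (3) $D=(r,s,t,1^{n-3})$, where $n\ge 3$, $r\ge s\ge t\ge 2$ and $r+s+t=n+3$.
   Context: All graphs are finite and simple. A sequence $D=(d_1,\ldots,d_n)$ of non-negative integers is graphic if there is a simple graph with vertices $v_1,\ldots,v_n$ with $\deg(v_i)=d_i$ for all $i$; such a graph is a realization of $D$. A graphic sequence $D$ is forcibly $\mathcal{P}$ graphic if every realization of $D$ has property $\mathcal{P}$. A graph of order $n$ is unicyclic if it is connected and has exactly $n$ edges. The notation $(a_1^{c_1},\ldots,a_k^{c_k})$ means the sequence in which $a_i$ appears $c_i$ times (exponent $0$ means the term is absent). *)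

theory Defs
  imports Main
begin

definition simple_graph :: "'a set \<Rightarrow> 'a set set \<Rightarrow> bool" where
  "simple_graph V E \<longleftrightarrow> finite V \<and> (\<forall>e\<in>E. e \<subseteq> V \<and> card e = 2)"

definition degree :: "'a set set \<Rightarrow> 'a \<Rightarrow> nat" where
  "degree E v = card {e \<in> E. v \<in> e}"

text \<open>By convention the graph with no vertices is not connected.\<close>

definition connected_graph :: "'a set \<Rightarrow> 'a set set \<Rightarrow> bool" where
  "connected_graph V E \<longleftrightarrow>
     V \<noteq> {} \<and> (\<forall>u\<in>V. \<forall>v\<in>V. (\<lambda>x y. {x, y} \<in> E)\<^sup>*\<^sup>* u v)"

definition unicyclic :: "'a set \<Rightarrow> 'a set set \<Rightarrow> bool" where
  "unicyclic V E \<longleftrightarrow> simple_graph V E \<and> connected_graph V E \<and> card E = card V"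

text \<open>Realizations of \<open>D\<close> are labelled graphs: the vertex \<open>v\<^sub>i\<close> of prescribed degree
  \<open>d\<^sub>i\<close> is represented by the list index \<open>i - 1\<close>.\<close>

definition realization :: "nat list \<Rightarrow> nat set set \<Rightarrow> bool" where
  "realization D E \<longleftrightarrow>
     simple_graph {..<length D} E \<and> (\<forall>i<length D. degree E i = D ! i)"

definition graphic :: "nat list \<Rightarrow> bool" where
  "graphic D \<longleftrightarrow> (\<exists>E. realization D E)"

definition forcibly_graphic :: "(nat set \<Rightarrow> nat set set \<Rightarrow> bool) \<Rightarrow> nat list \<Rightarrow> bool" where
  "forcibly_graphic P D \<longleftrightarrow>
     graphic D \<and> (\<forall>E. realization D E \<longrightarrow> P {..<length D} E)"

end

theory Submission
  imports Defs
begin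

text \<open>Call a vertex big if its degree is at least two, and let \<open>m\<close> be the number of big vertices.
  If all degrees are positive and there are \<open>n\<close> edges, then at most \<open>n - m\<close> edges meet a leaf, so
  at least \<open>m\<close> edges join big vertices, whence \<open>m \<ge> 3\<close>. Conversely any graph with \<open>m\<close> edges on the big
  vertices respecting the degree bounds extends to a realization by distributing leaves.
  For \<open>m \<ge> 6\<close> two disjoint 2-regular cores give a disconnected realization. For \<open>m = 4, 5\<close> a core
  with \<open>m + 1\<close> edges leaves two leaves over, which form a separate edge; such a core exists
  unless the degrees of the big vertices are \<open>(a, 2, 2, 2)\<close>, \<open>(2, 2, 2, 2, 2)\<close> or \<open>(3, 2, 2, 2, 2)\<close>.
  The remaining sequences force connectedness because a component with a vertex of degree \<open>d\<close>
  has more than \<open>d\<close> vertices, or, for \<open>m = 3\<close>, because the big vertices must form a triangle.\<close>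

section \<open>Graphs with prescribed degrees, and their components\<close>

text \<open>Unlike \<open>realization\<close>, this allows an arbitrary vertex set, so that the
  pieces of a disconnected realization can be built separately on subsets of the indices and then
  united.\<close>

definition has_degrees :: "'a set \<Rightarrow> ('a \<Rightarrow> nat) \<Rightarrow> 'a set set \<Rightarrow> bool" where
  "has_degrees V d E \<longleftrightarrow> simple_graph V E \<and> (\<forall>v\<in>V. degree E v = d v)"

lemma realization_iff_has_degrees:
  "realization D E \<longleftrightarrow> has_degrees {..<length D} ((!) D) E"
  by (auto simp: realization_def has_degrees_def)

lemma simple_graph_finite_edges:
  assumes "simple_graph V E"
  shows "finite E"
  using assms unfolding simple_graph_def by (meson PowI finite_Pow_iff finite_subset subsetI)

lemma degree_empty: "degree {} v = 0"
  by (simp add: degree_def)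

lemma degree_insert:
  assumes "finite E" "e \<notin> E"
  shows "degree (insert e E) v = (if v \<in> e then Suc (degree E v) else degree E v)"
proof -
  have "{x \<in> insert e E. v \<in> x} = (if v \<in> e then insert e {x \<in> E. v \<in> x} else {x \<in> E. v \<in> x})"
    by auto
  then show ?thesis
    using assms by (simp add: degree_def)
qed

text \<open>An edge at \<open>v\<close> is determined by its other end, which lies in
  \<open>S - {v}\<close>.\<close>

lemma degree_less_card:
  assumes "simple_graph V E" "finite S" "v \<in> S" "\<And>e. e \<in> E \<Longrightarrow> v \<in> e \<Longrightarrow> e \<subseteq> S"
  shows "degree E v < card S"
proof -
  have "{e \<in> E. v \<in> e} \<subseteq> (\<lambda>w. {v, w}) ` (S - {v})"
  proof
    fix e assume e: "e \<in> {e \<in> E. v \<in> e}"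
    then have "card e = 2" "v \<in> e" "e \<subseteq> S"
      using assms by (auto simp: simple_graph_def)
    then obtain w where "w \<noteq> v" "e = {v, w}"
      by (metis card_2_iff empty_iff insert_commute insert_iff)
    then show "e \<in> (\<lambda>w. {v, w}) ` (S - {v})"
      using \<open>e \<subseteq> S\<close> by auto
  qed
  then have "degree E v \<le> card (S - {v})"
    unfolding degree_def using assms(2) by (meson card_image_le card_mono finite_Diff finite_imageI le_trans)
  also have "\<dots> < card S"
    using assms(2,3) by (rule card_Diff1_less)
  finally show ?thesis .
qed

lemma handshake:
  assumes "simple_graph V E"
  shows "(\<Sum>v\<in>V. degree E v) = 2 * card E"
proof -
  have fin: "finite V" "finite E"
    using assms simple_graph_finite_edges by (auto simp: simple_graph_def)
  have "(\<Sum>v\<in>V. card {e \<in> E. v \<in> e}) = 2 * card E"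
  proof (rule sum_multicount[OF fin])
    show "\<forall>e\<in>E. card {v \<in> V. v \<in> e} = 2"
    proof
      fix e assume "e \<in> E"
      then have "{v \<in> V. v \<in> e} = e" "card e = 2"
        using assms by (auto simp: simple_graph_def)
      then show "card {v \<in> V. v \<in> e} = 2" by simp
    qed
  qed
  then show ?thesis by (simp add: degree_def)
qed

text \<open>\<open>T\<close> collects everything unreachable from \<open>u\<close>. It may be a
  union of several components; all that matters later is that no edge leaves it.\<close>

lemma disconnected_part:
  assumes G: "simple_graph V E" and "\<not> connected_graph V E" and u: "u \<in> V"
  obtains T where "T \<subseteq> V" "T \<noteq> {}" "u \<notin> T" "\<And>e. e \<in> E \<Longrightarrow> e \<inter> T \<noteq> {} \<Longrightarrow> e \<subseteq> T"
proof -
  let ?R = "\<lambda>x y. {x, y} \<in> E"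
  define T where "T = {v \<in> V. \<not> ?R\<^sup>*\<^sup>* u v}"
  have sym: "?R\<^sup>*\<^sup>* y x" if "?R\<^sup>*\<^sup>* x y" for x y
  proof -
    have "symp ?R" by (auto simp: symp_def insert_commute)
    then show ?thesis using that by (meson sympD symp_rtranclp)
  qed
  have "T \<noteq> {}"
  proof
    assume "T = {}"
    then have "?R\<^sup>*\<^sup>* u v" if "v \<in> V" for v
      using that by (auto simp: T_def)
    then have "?R\<^sup>*\<^sup>* v w" if "v \<in> V" "w \<in> V" for v w
      using that by (blast intro: rtranclp_trans sym)
    then show False
      using assms(2) u by (auto simp: connected_graph_def)
  qed
  moreover have "e \<subseteq> T" if e: "e \<in> E" "e \<inter> T \<noteq> {}" for e
  proof
    fix y assume y: "y \<in> e"
    obtain x where x: "x \<in> e" "x \<in> T" using e by auto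
    have sub: "card e = 2" "e \<subseteq> V" using G e by (auto simp: simple_graph_def)
    show "y \<in> T"
    proof (cases "x = y")
      case False
      then have "e = {y, x}"
        using sub x y by (auto simp: card_2_iff)
      then have "?R y x" using e by simp
      then have "\<not> ?R\<^sup>*\<^sup>* u y"
        using x by (auto simp: T_def intro: rtranclp.rtrancl_into_rtrancl)
      then show ?thesis using y sub by (auto simp: T_def)
    qed (use x in simp)
  qed
  ultimately show ?thesis
    by (intro that[of T]) (auto simp: T_def)
qed

section \<open>Disjoint unions\<close>

lemma disjoint_union:
  assumes 1: "has_degrees V1 d E1" and 2: "has_degrees V2 d E2" and dis: "V1 \<inter> V2 = {}"
  shows "has_degrees (V1 \<union> V2) d (E1 \<union> E2)"
proof -
  have e1: "e \<subseteq> V1" if "e \<in> E1" for e using that 1 by (auto simp: has_degrees_def simple_graph_def)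
  have e2: "e \<subseteq> V2" if "e \<in> E2" for e using that 2 by (auto simp: has_degrees_def simple_graph_def)
  have "{e \<in> E1 \<union> E2. v \<in> e} = {e \<in> E1. v \<in> e}" if "v \<in> V1" for v
    using e2 dis that by blast
  moreover have "{e \<in> E1 \<union> E2. v \<in> e} = {e \<in> E2. v \<in> e}" if "v \<in> V2" for v
    using e1 dis that by blast
  ultimately have "\<forall>v\<in>V1 \<union> V2. degree (E1 \<union> E2) v = d v"
    using 1 2 by (auto simp: has_degrees_def degree_def)
  then show ?thesis
    using 1 2 by (auto simp: has_degrees_def simple_graph_def)
qed

lemma disjoint_union_disconnected:
  assumes 1: "simple_graph V1 E1" and 2: "simple_graph V2 E2" and dis: "V1 \<inter> V2 = {}"
    and ne: "V1 \<noteq> {}" "V2 \<noteq> {}"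
  shows "\<not> connected_graph (V1 \<union> V2) (E1 \<union> E2)"
proof
  assume con: "connected_graph (V1 \<union> V2) (E1 \<union> E2)"
  obtain u v where uv: "u \<in> V1" "v \<in> V2" using ne by auto
  then have "(\<lambda>x y. {x, y} \<in> E1 \<union> E2)\<^sup>*\<^sup>* u v"
    using con by (auto simp: connected_graph_def)
  then have "v \<in> V1"
  proof induction
    case base
    show ?case by (rule uv)
  next
    case (step y z)
    have "{y, z} \<notin> E2"
      using step.IH dis 2 by (fastforce simp: simple_graph_def)
    then show ?case using step 1 by (auto simp: simple_graph_def)
  qed
  then show False using uv dis by auto
qed

section \<open>Extending a core by leaves\<close>

text \<open>In the application \<open>f\<close> sends each leaf to its neighbour, and
  \<open>g a\<close> is the number of leaves that the core vertex \<open>a\<close> still has to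
  receive.\<close>

lemma ex_fibre_sizes:
  assumes "finite A" "finite L" "sum g A = card L"
  shows "\<exists>f. f ` L \<subseteq> A \<and> (\<forall>a\<in>A. card {l \<in> L. f l = a} = g a)"
  using assms
proof (induction A arbitrary: L rule: finite_induct)
  case empty
  then show ?case by auto
next
  case (insert a A)
  then obtain K where K: "K \<subseteq> L" "card K = g a"
    using obtain_subset_with_card_n[of "g a" L] by (metis le_add1 sum.insert)
  then have "sum g A = card (L - K)"
    using insert by (simp add: card_Diff_subset finite_subset)
  then obtain f where f: "f ` (L - K) \<subseteq> A" "\<forall>a\<in>A. card {l \<in> L - K. f l = a} = g a"
    using insert.IH[of "L - K"] insert.prems by auto
  let ?f = "\<lambda>l. if l \<in> K then a else f l"
  have "{l \<in> L. ?f l = a} = K"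
    using K f insert.hyps by auto
  moreover have "{l \<in> L. ?f l = b} = {l \<in> L - K. f l = b}" if "b \<in> A" for b
    using that insert.hyps K by auto
  ultimately have "\<forall>b\<in>insert a A. card {l \<in> L. ?f l = b} = g b"
    using K f by auto
  moreover have "?f ` L \<subseteq> insert a A"
    using f by auto
  ultimately show ?case by (intro exI[of _ ?f]) simp
qed

text \<open>By the handshake identity, \<open>total\<close> says that the degrees missing in the
  core \<open>F\<close> add up to exactly the number of leaves, so every leaf finds a place and
  every deficit is filled.\<close>

lemma attach_leaves:
  assumes F: "simple_graph V F" and fin: "finite L" and dis: "V \<inter> L = {}"
    and le: "\<And>v. v \<in> V \<Longrightarrow> degree F v \<le> d v" and leaf: "\<And>l. l \<in> L \<Longrightarrow> d l = 1"
    and total: "sum d V = 2 * card F + card L"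
  shows "\<exists>E. has_degrees (V \<union> L) d E"
proof -
  have finV: "finite V" using F by (simp add: simple_graph_def)
  have FV: "e \<subseteq> V" if "e \<in> F" for e using that F by (auto simp: simple_graph_def)
  have "(\<Sum>v\<in>V. d v - degree F v) = card L"
    using total le handshake[OF F] by (subst sum_subtractf_nat) auto
  then obtain f where f: "f ` L \<subseteq> V" "\<And>v. v \<in> V \<Longrightarrow> card {l \<in> L. f l = v} = d v - degree F v"
    using ex_fibre_sizes[OF finV fin, of "\<lambda>v. d v - degree F v"] by auto
  define E where "E = F \<union> (\<lambda>l. {f l, l}) ` L"
  have "e \<subseteq> V \<union> L \<and> card e = 2" if e: "e \<in> E" for e
  proof -
    consider "e \<in> F" | l where "l \<in> L" "e = {f l, l}"
      using e by (auto simp: E_def)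
    then show ?thesis
    proof cases
      case 1
      then show ?thesis using F by (auto simp: simple_graph_def)
    next
      case 2
      then have "f l \<in> V" using f by auto
      moreover have "f l \<noteq> l" using \<open>f l \<in> V\<close> 2 dis by auto
      ultimately show ?thesis using 2 by auto
    qed
  qed
  then have "simple_graph (V \<union> L) E"
    using finV fin by (simp add: simple_graph_def)
  moreover have "degree E v = d v" if v: "v \<in> V" for v
  proof -
    have "v \<notin> L" using v dis by auto
    then have eq: "{e \<in> E. v \<in> e} = {e \<in> F. v \<in> e} \<union> (\<lambda>l. {v, l}) ` {l \<in> L. f l = v}"
      by (auto simp: E_def)
    have "card ((\<lambda>l. {v, l}) ` {l \<in> L. f l = v}) = d v - degree F v"
      by (subst card_image) (auto simp: inj_on_def doubleton_eq_iff f v)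
    moreover have "{e \<in> F. v \<in> e} \<inter> (\<lambda>l. {v, l}) ` {l \<in> L. f l = v} = {}"
      using FV dis by blast
    ultimately have "degree E v = degree F v + (d v - degree F v)"
      using simple_graph_finite_edges[OF F] fin
      unfolding degree_def eq by (subst card_Un_disjoint) auto
    then show ?thesis using le[OF v] by simp
  qed
  moreover have "degree E l = d l" if l: "l \<in> L" for l
  proof -
    have "l \<noteq> f k" if "k \<in> L" for k using that l f dis by blast
    then have "{e \<in> E. l \<in> e} = {{f l, l}}"
      using FV dis l by (auto simp: E_def)
    then show ?thesis using leaf[OF l] by (simp add: degree_def)
  qed
  ultimately show ?thesis by (auto simp: has_degrees_def)
qed

section \<open>Disconnected realizations\<close>

lemma not_forcibly_unicyclic:
  assumes "has_degrees V1 ((!) D) E1" "has_degrees V2 ((!) D) E2" "V1 \<inter> V2 = {}"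
    "V1 \<noteq> {}" "V2 \<noteq> {}" "V1 \<union> V2 = {..<length D}"
  shows "\<not> forcibly_graphic unicyclic D"
proof -
  have "realization D (E1 \<union> E2)"
    using disjoint_union[OF assms(1-3)] assms(6) by (simp add: realization_iff_has_degrees)
  moreover have "\<not> connected_graph {..<length D} (E1 \<union> E2)"
    using disjoint_union_disconnected[of V1 E1 V2 E2] assms by (simp add: has_degrees_def)
  ultimately show ?thesis
    by (auto simp: forcibly_graphic_def unicyclic_def)
qed

text \<open>Cycles are written out for 3, 4 and 5 vertices. From 6 on a triangle is split off, which
  leaves at least 3 vertices for the induction; the result need not be connected.\<close>

lemma ex_two_regular_graph:
  assumes "finite A" "card A \<ge> 3"
  shows "\<exists>F. has_degrees A (\<lambda>_. 2) F"
  using assms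
proof (induction "card A" arbitrary: A rule: less_induct)
  case less
  consider "card A = 3" | "card A = Suc 3" | "card A = Suc (Suc 3)" | "card A \<ge> 6"
    using less.prems by linarith
  then show ?case
  proof cases
    case 1
    then obtain a b c where "A = {a, b, c}" "distinct [a, b, c]"
      by (auto simp: card_3_iff)
    then have "has_degrees A (\<lambda>_. 2) {{a, b}, {b, c}, {c, a}}"
      by (auto simp: has_degrees_def simple_graph_def degree_insert degree_empty doubleton_eq_iff)
    then show ?thesis by blast
  next
    case 2
    then obtain a B where "A = insert a B" "a \<notin> B" "card B = 3"
      unfolding card_Suc_eq by blast
    then obtain b c d where "A = {a, b, c, d}" "distinct [a, b, c, d]"
      by (auto simp: card_3_iff)
    then have "has_degrees A (\<lambda>_. 2) {{a, b}, {b, c}, {c, d}, {d, a}}"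
      by (auto simp: has_degrees_def simple_graph_def degree_insert degree_empty doubleton_eq_iff)
    then show ?thesis by blast
  next
    case 3
    then obtain a B where B: "A = insert a B" "a \<notin> B" "card B = Suc 3"
      unfolding card_Suc_eq[of A] by blast
    then obtain b C where "B = insert b C" "b \<notin> C" "card C = 3"
      unfolding card_Suc_eq by blast
    with B obtain c d e where "A = {a, b, c, d, e}" "distinct [a, b, c, d, e]"
      by (auto simp: card_3_iff)
    then have "has_degrees A (\<lambda>_. 2) {{a, b}, {b, c}, {c, d}, {d, e}, {e, a}}"
      by (auto simp: has_degrees_def simple_graph_def degree_insert degree_empty doubleton_eq_iff)
    then show ?thesis by blast
  next
    case 4
    then obtain B where B: "B \<subseteq> A" "card B = 3" "finite B"
      using obtain_subset_with_card_n[of 3 A] by auto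
    then have "card (A - B) < card A" "card (A - B) \<ge> 3"
      using 4 by (simp_all add: card_Diff_subset)
    then obtain F1 F2 where "has_degrees B (\<lambda>_. 2) F1" "has_degrees (A - B) (\<lambda>_. 2) F2"
      using less.hyps[of B] less.hyps[of "A - B"] 4 B less.prems by auto
    then show ?thesis
      using disjoint_union[of B "\<lambda>_. 2" F1 "A - B" F2] B by (metis Diff_disjoint Diff_partition)
  qed
qed

text \<open>A 2-regular core has as many edges as vertices, which turns the degree sum given here
  into the one that \<open>attach_leaves\<close> asks for.\<close>

lemma ex_regular_core_with_leaves:
  assumes "finite A" "card A \<ge> 3" "finite L" "A \<inter> L = {}"
    and "\<And>a. a \<in> A \<Longrightarrow> d a \<ge> 2" "\<And>l. l \<in> L \<Longrightarrow> d l = 1" "sum d A = 2 * card A + card L"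
  shows "\<exists>E. has_degrees (A \<union> L) d E"
proof -
  obtain F where F: "has_degrees A (\<lambda>_. 2) F"
    using ex_two_regular_graph assms(1,2) by blast
  then have "2 * card F = 2 * card A"
    using handshake[of A F] by (simp add: has_degrees_def)
  then show ?thesis
    using attach_leaves[of A F L d] F assms by (simp add: has_degrees_def)
qed

text \<open>The first three big vertices and the remaining \<open>m - 3 \<ge> 3\<close> carry
  separate 2-regular cores, and each core takes its own share of the leaves.\<close>

lemma two_cycles_not_forcibly_unicyclic:
  assumes m: "6 \<le> m" "m \<le> length D"
    and big: "\<And>i. i < m \<Longrightarrow> D ! i \<ge> 2"
    and leaf: "\<And>i. m \<le> i \<Longrightarrow> i < length D \<Longrightarrow> D ! i = 1"
    and total: "(\<Sum>i<m. D ! i) = length D + m"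
  shows "\<not> forcibly_graphic unicyclic D"
proof -
  \<comment> \<open>The leaves \<open>m, ..., k - 1\<close> go to the first three vertices: their
    number is the surplus of those degrees over 2 each. The subtraction does not truncate, as the
    three degrees sum to at least 6.\<close>
  define k where "k = m + ((\<Sum>i<3. D ! i) - 6)"
  have lower: "2 * card A \<le> sum ((!) D) A" if "A \<subseteq> {..<m}" for A
    using sum_bounded_below[of A 2 "(!) D"] big that by (auto simp: mult.commute)
  have split: "(\<Sum>i<m. D ! i) = (\<Sum>i<3. D ! i) + (\<Sum>i\<in>{3..<m}. D ! i)"
    using m by (subst sum.union_disjoint[symmetric]) (auto intro!: sum.cong)
  have "6 \<le> (\<Sum>i<3. D ! i)" "2 * (m - 3) \<le> (\<Sum>i\<in>{3..<m}. D ! i)"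
    using lower[of "{..<3}"] lower[of "{3..<m}"] m by (auto simp: subset_iff)
  then have sums: "(\<Sum>i<3. D ! i) = 6 + (k - m)" "(\<Sum>i\<in>{3..<m}. D ! i) = 2 * (m - 3) + (length D - k)"
    and k: "m \<le> k" "k \<le> length D"
    using split total m unfolding k_def by linarith+
  obtain E1 where "has_degrees ({..<3} \<union> {m..<k}) ((!) D) E1"
    using ex_regular_core_with_leaves[of "{..<3}" "{m..<k}" "(!) D"] sums big leaf m k by fastforce
  moreover obtain E2 where "has_degrees ({3..<m} \<union> {k..<length D}) ((!) D) E2"
    using ex_regular_core_with_leaves[of "{3..<m}" "{k..<length D}" "(!) D"] sums big leaf m k by fastforce
  ultimately show ?thesis
    by (rule not_forcibly_unicyclic) (use m k in \<open>auto simp: lessThan_empty_iff\<close>)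
qed

text \<open>A core with one edge more than a unicyclic graph leaves two of the vertices of degree one
  free, and these are joined to form a component of their own.\<close>

lemma bicyclic_core_not_forcibly_unicyclic:
  assumes F: "simple_graph {..<m} F" "card F = Suc m" and m: "m \<le> length D"
    and core: "\<And>i. i < m \<Longrightarrow> degree F i \<le> D ! i"
    and leaf: "\<And>i. m \<le> i \<Longrightarrow> i < length D \<Longrightarrow> D ! i = 1"
    and total: "(\<Sum>i<m. D ! i) = length D + m"
  shows "\<not> forcibly_graphic unicyclic D"
proof -
  define n where "n = length D"
  \<comment> \<open>The core has degree sum \<open>2 * (m + 1)\<close>, and this is at most
    \<open>n + m\<close>; hence there are at least two leaves.\<close>
  have "(\<Sum>i<m. degree F i) \<le> (\<Sum>i<m. D ! i)"
    by (rule sum_mono) (use core in auto)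
  then have n: "m + 2 \<le> n"
    using handshake[OF F(1)] F(2) total by (simp add: n_def)
  \<comment> \<open>The count fits because \<open>n + m = 2 * (m + 1) + (n - 2 - m)\<close>.\<close>
  obtain E where "has_degrees ({..<m} \<union> {m..<n - 2}) ((!) D) E"
    using attach_leaves[of "{..<m}" F "{m..<n - 2}" "(!) D"] F core leaf total n
    by (fastforce simp: n_def)
  moreover have "has_degrees {n - 2, n - 1} ((!) D) {{n - 2, n - 1}}"
    using n leaf[of "n - 2"] leaf[of "n - 1"]
    by (auto simp: has_degrees_def simple_graph_def degree_insert degree_empty n_def)
  moreover have "0 < m"
    using total n by (cases m) (auto simp: n_def)
  ultimately show ?thesis
    by (intro not_forcibly_unicyclic[of "{..<m} \<union> {m..<n - 2}" D E "{n - 2, n - 1}"])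
      (use n in \<open>auto simp: n_def\<close>)
qed


section \<open>Counting the edges at leaves and between big vertices\<close>

lemma leaf_edges_le:
  assumes "finite L" "\<And>l. l \<in> L \<Longrightarrow> degree E l = 1"
  shows "card {e \<in> E. e \<inter> L \<noteq> {}} \<le> card L"
proof -
  have "{e \<in> E. e \<inter> L \<noteq> {}} = (\<Union>l\<in>L. {e \<in> E. l \<in> e})"
    by blast
  also have "card \<dots> \<le> (\<Sum>l\<in>L. card {e \<in> E. l \<in> e})"
    by (rule card_UN_le[OF assms(1)])
  also have "\<dots> = card L"
    using assms(2) by (simp add: degree_def)
  finally show ?thesis .
qed

text \<open>An edge \<open>{x, y}\<close> between two leaves is the only edge at \<open>x\<close>
  and still meets \<open>L\<close> in \<open>y\<close>. Dropping \<open>x\<close> from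
  \<open>L\<close> therefore loses no edge, and the previous bound improves by one.\<close>

lemma leaf_edges_less:
  assumes G: "simple_graph V E" and fin: "finite L" and deg: "\<And>l. l \<in> L \<Longrightarrow> degree E l = 1"
    and e: "e \<in> E" "e \<subseteq> L"
  shows "card {e \<in> E. e \<inter> L \<noteq> {}} < card L"
proof -
  have "card e = 2" using G e by (auto simp: simple_graph_def)
  then obtain x y where xy: "e = {x, y}" "x \<noteq> y"
    by (auto simp: card_2_iff)
  then have "card {f \<in> E. x \<in> f} = 1"
    using deg[of x] e by (simp add: degree_def)
  then obtain g where g: "{f \<in> E. x \<in> f} = {g}"
    by (rule card_1_singletonE)
  have "f = e" if "f \<in> E" "x \<in> f" for f
  proof -
    have "f \<in> {g}" "e \<in> {g}"
      using that e xy unfolding g[symmetric] by auto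
    then show ?thesis by simp
  qed
  then have "{f \<in> E. f \<inter> L \<noteq> {}} = {f \<in> E. f \<inter> (L - {x}) \<noteq> {}}"
    using xy e by blast
  also have "card \<dots> \<le> card (L - {x})"
    using leaf_edges_le[of "L - {x}" E] fin deg by simp
  also have "\<dots> < card L"
    using xy e fin by (intro card_Diff1_less) auto
  finally show ?thesis .
qed

lemma card_core_edges:
  assumes G: "simple_graph V E" and "V = B \<union> L" "B \<inter> L = {}"
  shows "card E = card {e \<in> E. e \<subseteq> B} + card {e \<in> E. e \<inter> L \<noteq> {}}"
proof -
  have fin: "finite E" and sub: "\<And>e. e \<in> E \<Longrightarrow> e \<subseteq> B \<union> L"
    using simple_graph_finite_edges[OF G] G assms(2) by (auto simp: simple_graph_def)
  have "{e \<in> E. e \<subseteq> B} \<union> {e \<in> E. e \<inter> L \<noteq> {}} = E"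
    using sub by blast
  moreover have "e \<inter> L = {}" if "e \<subseteq> B" for e
    using that assms(3) by blast
  then have "{e \<in> E. e \<subseteq> B} \<inter> {e \<in> E. e \<inter> L \<noteq> {}} = {}"
    by blast
  ultimately show ?thesis
    using fin card_Un_disjoint[of "{e \<in> E. e \<subseteq> B}" "{e \<in> E. e \<inter> L \<noteq> {}}"] by simp
qed

lemma card_core_edges_le:
  assumes "simple_graph V E" "finite B"
  shows "card {e \<in> E. e \<subseteq> B} \<le> card B choose 2"
proof -
  have "card {e \<in> E. e \<subseteq> B} \<le> card {e. e \<subseteq> B \<and> card e = 2}"
    using assms by (intro card_mono) (auto simp: simple_graph_def)
  then show ?thesis
    by (simp add: n_subsets[OF assms(2)])
qed

section \<open>Reduction to degree sums and connectedness\<close>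

lemma sum_degrees:
  assumes "m \<le> length D" "\<And>i. m \<le> i \<Longrightarrow> i < length D \<Longrightarrow> D ! i = 1"
  shows "(\<Sum>i<length D. D ! i) = (\<Sum>i<m. D ! i) + (length D - m)"
proof -
  have "(\<Sum>i<length D. D ! i) = (\<Sum>i<m. D ! i) + (\<Sum>i\<in>{m..<length D}. D ! i)"
    using assms(1) by (subst sum.union_disjoint[symmetric]) (auto intro!: sum.cong)
  then show ?thesis
    using assms(2) by simp
qed

lemma realization_card_edges:
  assumes "realization D E"
  shows "2 * card E = (\<Sum>i<length D. D ! i)"
  using handshake[of "{..<length D}" E] assms by (simp add: realization_def)

text \<open>A 2-regular core with leaves shows that \<open>D\<close> is graphic, and the degree sum
  fixes the number of edges of every realization. Only connectedness remains for the individual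
  sequences.\<close>

lemma forcibly_unicyclicI:
  assumes m: "3 \<le> m" "m \<le> length D"
    and big: "\<And>i. i < m \<Longrightarrow> D ! i \<ge> 2"
    and leaf: "\<And>i. m \<le> i \<Longrightarrow> i < length D \<Longrightarrow> D ! i = 1"
    and total: "(\<Sum>i<m. D ! i) = length D + m"
    and connected: "\<And>E. realization D E \<Longrightarrow> card E = length D \<Longrightarrow> connected_graph {..<length D} E"
  shows "forcibly_graphic unicyclic D"
proof -
  have "{..<length D} = {..<m} \<union> {m..<length D}"
    using m by auto
  moreover have "\<exists>E. has_degrees ({..<m} \<union> {m..<length D}) ((!) D) E"
    using m big leaf total by (intro ex_regular_core_with_leaves) auto
  ultimately have "graphic D"
    by (simp add: graphic_def realization_iff_has_degrees)
  moreover have "unicyclic {..<length D} E" if E: "realization D E" for E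
  proof -
    have "card E = length D"
      using realization_card_edges[OF E] sum_degrees[OF m(2) leaf] total m by simp
    then show ?thesis
      using connected[OF E] E by (simp add: unicyclic_def realization_def)
  qed
  ultimately show ?thesis
    by (simp add: forcibly_graphic_def)
qed

text \<open>One realization suffices: its connectedness makes all degrees positive, so by
  monotonicity the big entries form a prefix followed by ones. Its edge count gives the sum, and
  counting the edges between big vertices gives \<open>m \<ge> 3\<close>.\<close>

lemma forcibly_unicyclicE:
  assumes D: "forcibly_graphic unicyclic D" and sorted: "sorted_wrt (\<ge>) D"
  obtains m where "3 \<le> m" "m \<le> length D" "\<And>i. i < m \<Longrightarrow> D ! i \<ge> 2"
    "\<And>i. m \<le> i \<Longrightarrow> i < length D \<Longrightarrow> D ! i = 1" "(\<Sum>i<m. D ! i) = length D + m"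
proof -
  define n where "n = length D"
  obtain E where E: "realization D E"
    using D by (auto simp: forcibly_graphic_def graphic_def)
  then have "unicyclic {..<n} E"
    using D by (simp add: forcibly_graphic_def n_def)
  then have G: "simple_graph {..<n} E" and con: "connected_graph {..<n} E" and card: "card E = n"
    by (auto simp: unicyclic_def)
  have n0: "n > 0" using con by (auto simp: connected_graph_def)
  then obtain e where "e \<in> E"
    using card by (metis card.empty ex_in_conv less_irrefl)
  then have "card e = 2" "card e \<le> n"
    using G card_mono[of "{..<n}" e] by (auto simp: simple_graph_def)
  then have n2: "n \<ge> 2" by simp
  have pos: "D ! i \<ge> 1" if i: "i < n" for i
  \<comment> \<open>A path from \<open>i\<close> to some other vertex \<open>j\<close> must start
    with an edge at \<open>i\<close>; this is where \<open>n \<ge> 2\<close> enters.\<close>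
  proof -
    obtain j where j: "j < n" "j \<noteq> i"
      using n2 that[of "if i = 0 then 1 else 0"] by (auto split: if_splits)
    then have "(\<lambda>x y. {x, y} \<in> E)\<^sup>*\<^sup>* i j"
      using con i by (auto simp: connected_graph_def)
    then obtain k where "{i, k} \<in> E"
      using j by (blast elim: converse_rtranclpE)
    then have "{e \<in> E. i \<in> e} \<noteq> {}" by auto
    then have "degree E i \<noteq> 0"
      using simple_graph_finite_edges[OF G] by (simp add: degree_def)
    then show ?thesis
      using E i by (simp add: realization_def n_def)
  qed
  define m where "m = length (takeWhile (\<lambda>x. x \<ge> 2) D)"
  have m: "m \<le> n"
    by (simp add: m_def n_def length_takeWhile_le)
  have big: "D ! i \<ge> 2" if "i < m" for i
    using that nth_mem[of i "takeWhile (\<lambda>x. x \<ge> 2) D"]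
    by (auto simp: m_def takeWhile_nth dest: set_takeWhileD)
  have leaf: "D ! i = 1" if i: "m \<le> i" "i < n" for i
  proof -
    have "\<not> D ! m \<ge> 2"
      using nth_length_takeWhile[of "\<lambda>x. x \<ge> 2" D] i by (simp add: m_def n_def)
    moreover have "D ! i \<le> D ! m"
      using sorted_wrt_nth_less[OF sorted, of m i] i by (cases "m = i") (auto simp: n_def)
    ultimately show ?thesis
      using pos[OF i(2)] by simp
  qed
  have total: "(\<Sum>i<m. D ! i) = n + m"
    using realization_card_edges[OF E] sum_degrees[of m D] card m leaf by (simp add: n_def)
  have "card {e \<in> E. e \<inter> {m..<n} \<noteq> {}} \<le> n - m"
    using leaf_edges_le[of "{m..<n}" E] leaf E by (simp add: realization_def n_def)
  moreover have "card E = card {e \<in> E. e \<subseteq> {..<m}} + card {e \<in> E. e \<inter> {m..<n} \<noteq> {}}"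
    using m by (intro card_core_edges[OF G]) auto
  ultimately have "m \<le> card {e \<in> E. e \<subseteq> {..<m}}"
    using card m by linarith
  also have "\<dots> \<le> m choose 2"
    using card_core_edges_le[OF G, of "{..<m}"] by simp
  finally have "m \<le> m choose 2" .
  \<comment> \<open>The bound \<open>m \<le> m choose 2\<close> excludes 1 and 2 but holds for 0, so
    0 is excluded separately by the degree sum.\<close>
  moreover have "m \<noteq> 0"
    using total n0 by (intro notI) simp
  ultimately have "m \<ge> 3"
    by (cases "m = 1 \<or> m = 2") (auto simp: numeral_eq_Suc)
  then show ?thesis
    using that[of m] m big leaf total by (simp add: n_def)
qed

text \<open>\<open>T\<close> is the part unreachable from vertex 0, which has the largest degree in
  the applications. Vertex 0 and its neighbours lie outside \<open>T\<close>, while each vertex of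
  \<open>T\<close> has all its neighbours inside, so both sides must be large.\<close>

lemma disconnected_realization:
  assumes E: "realization D E" and "\<not> connected_graph {..<length D} E" and "D \<noteq> []"
  obtains T where "T \<subseteq> {0<..<length D}" "T \<noteq> {}" "D ! 0 + card T < length D"
    "\<And>v. v \<in> T \<Longrightarrow> D ! v < card T" "\<And>e. e \<in> E \<Longrightarrow> e \<inter> T \<noteq> {} \<Longrightarrow> e \<subseteq> T"
proof -
  let ?V = "{..<length D}"
  have G: "simple_graph ?V E" and deg: "\<And>i. i < length D \<Longrightarrow> degree E i = D ! i"
    using E by (auto simp: realization_def)
  obtain T where T: "T \<subseteq> ?V" "T \<noteq> {}" "0 \<notin> T" "\<And>e. e \<in> E \<Longrightarrow> e \<inter> T \<noteq> {} \<Longrightarrow> e \<subseteq> T"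
    using disconnected_part[OF G assms(2), of 0] assms(3) by auto
  then have fin: "finite T" by (meson finite_lessThan finite_subset)
  have "D ! v < card T" if "v \<in> T" for v
  proof -
    have "degree E v < card T"
      by (rule degree_less_card[OF G fin that]) (use T(4) that in blast)
    then show ?thesis
      using deg[of v] T(1) that by auto
  qed
  moreover have "degree E 0 < card (?V - T)"
  proof (rule degree_less_card[OF G])
    fix e assume "e \<in> E" "0 \<in> e"
    then show "e \<subseteq> ?V - T"
      using T(3,4) G by (auto simp: simple_graph_def)
  qed (use T assms(3) in auto)
  then have "D ! 0 + card T < length D"
    using deg[of 0] assms(3) T(1) fin by (simp add: card_Diff_subset)
  moreover have "T \<subseteq> {0<..<length D}"
    using T(1,3) by (force simp: greaterThanLessThan_def intro!: gr0I)
  ultimately show ?thesis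
    using that T(2,4) by blast
qed

section \<open>The listed sequences are forcibly unicyclic\<close>

text \<open>Both \<open>T\<close> and its complement would need at least three of the five
  vertices.\<close>

lemma forcibly_unicyclic_two_five: "forcibly_graphic unicyclic (replicate 5 2)"
proof (rule forcibly_unicyclicI[where m = 5])
  let ?D = "replicate 5 (2 :: nat)"
  fix E :: "nat set set"
  assume E: "realization ?D E"
  show "connected_graph {..<length ?D} E"
  proof (rule ccontr)
    assume disconnected: "\<not> ?thesis"
    obtain T where T: "T \<subseteq> {0<..<length ?D}" "T \<noteq> {}" "?D ! 0 + card T < length ?D"
      "\<And>v. v \<in> T \<Longrightarrow> ?D ! v < card T" "\<And>e. e \<in> E \<Longrightarrow> e \<inter> T \<noteq> {} \<Longrightarrow> e \<subseteq> T"
      by (rule disconnected_realization[OF E disconnected]) auto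
    then obtain v where v: "v \<in> T" "v < 5" by fastforce
    then show False using T(3) T(4)[of v] by simp
  qed
qed auto

text \<open>The complement of \<open>T\<close> takes at least four of the six vertices, so
  \<open>T\<close> has at most two and cannot contain a vertex of degree 2. Only the single leaf is
  left, and it has no neighbour in \<open>T\<close>.\<close>

lemma forcibly_unicyclic_three_two_four_one:
  "forcibly_graphic unicyclic ([3] @ replicate 4 2 @ [1])"
proof (rule forcibly_unicyclicI[where m = 5])
  let ?D = "[3] @ replicate 4 2 @ [1 :: nat]"
  show "?D ! i \<ge> 2" if "i < 5" for i
    using that by (auto simp: nth_Cons' nth_append)
  show "?D ! i = 1" if "5 \<le> i" "i < length ?D" for i
    using that by (auto simp: nth_Cons' nth_append)
  show "(\<Sum>i<5. ?D ! i) = length ?D + 5"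
    by (simp add: numeral_eq_Suc)
  fix E :: "nat set set"
  assume E: "realization ?D E"
  show "connected_graph {..<length ?D} E"
  proof (rule ccontr)
    assume disconnected: "\<not> ?thesis"
    obtain T where T: "T \<subseteq> {0<..<length ?D}" "T \<noteq> {}" "?D ! 0 + card T < length ?D"
      "\<And>v. v \<in> T \<Longrightarrow> ?D ! v < card T" "\<And>e. e \<in> E \<Longrightarrow> e \<inter> T \<noteq> {} \<Longrightarrow> e \<subseteq> T"
      by (rule disconnected_realization[OF E disconnected]) auto
    have "v = 5" if v: "v \<in> T" for v
    proof -
      have "card T < 3" using T(3) by simp
      then have "?D ! v < 2" using T(4)[OF v] by linarith
      moreover have "v < 6" using T(1) v by auto
      ultimately show ?thesis by (auto simp: nth_Cons' nth_append split: if_splits)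
    qed
    then have "T = {5}" using T(2) by blast
    then show False using T(4)[of 5] by (simp add: nth_append)
  qed
qed auto

text \<open>Vertex 0 and its neighbours leave at most one vertex for \<open>T\<close>, which would
  have to be isolated.\<close>

lemma forcibly_unicyclic_four_cycle:
  assumes n: "n \<ge> 4"
  shows "forcibly_graphic unicyclic ([n - 2] @ replicate 3 2 @ replicate (n - 4) 1)"
    (is "forcibly_graphic unicyclic ?D")
proof (rule forcibly_unicyclicI[where m = 4])
  have len: "length ?D = n" using n by simp
  show "4 \<le> length ?D" using n by simp
  show "?D ! i \<ge> 2" if "i < 4" for i
    using that n by (auto simp: nth_Cons' nth_append)
  show "?D ! i = 1" if "4 \<le> i" "i < length ?D" for i
    using that n by (auto simp: nth_Cons' nth_append)
  show "(\<Sum>i<4. ?D ! i) = length ?D + 4"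
    using n by (simp add: numeral_eq_Suc)
  fix E :: "nat set set"
  assume E: "realization ?D E"
  show "connected_graph {..<length ?D} E"
  proof (rule ccontr)
    assume disconnected: "\<not> ?thesis"
    obtain T where T: "T \<subseteq> {0<..<length ?D}" "T \<noteq> {}" "?D ! 0 + card T < length ?D"
      "\<And>v. v \<in> T \<Longrightarrow> ?D ! v < card T" "\<And>e. e \<in> E \<Longrightarrow> e \<inter> T \<noteq> {} \<Longrightarrow> e \<subseteq> T"
      by (rule disconnected_realization[OF E disconnected]) auto
    then obtain v where v: "v \<in> T" by auto
    have "card T < 2" using T(3) n by simp
    then have "?D ! v < 1" using T(4)[OF v] by linarith
    moreover have "v < n" using T(1) v n by auto
    ultimately show False using n by (auto simp: nth_Cons' nth_append split: if_splits)
  qed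
qed simp

text \<open>At most \<open>n - 3\<close> edges meet a leaf and at most 3 join big vertices. As there
  are \<open>n\<close> edges, both bounds are attained: the big vertices form a triangle and no edge
  joins two leaves. But \<open>T\<close> would avoid the triangle and so contain an edge between
  leaves.\<close>

lemma forcibly_unicyclic_triangle:
  assumes n: "n \<ge> 3" and rst: "r \<ge> s" "s \<ge> t" "t \<ge> 2" "r + s + t = n + 3"
  shows "forcibly_graphic unicyclic ([r, s, t] @ replicate (n - 3) 1)"
    (is "forcibly_graphic unicyclic ?D")
proof (rule forcibly_unicyclicI[where m = 3])
  have len: "length ?D = n" using n by simp
  show "3 \<le> length ?D" using n by simp
  show "?D ! i \<ge> 2" if "i < 3" for i
    using that rst by (auto simp: nth_Cons' nth_append)
  show leaf: "?D ! i = 1" if "3 \<le> i" "i < length ?D" for i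
    using that n by (auto simp: nth_Cons' nth_append)
  show "(\<Sum>i<3. ?D ! i) = length ?D + 3"
    using n rst by (simp add: numeral_eq_Suc)
  fix E :: "nat set set"
  assume E: "realization ?D E" and card: "card E = length ?D"
  show "connected_graph {..<length ?D} E"
  proof (rule ccontr)
    assume disconnected: "\<not> ?thesis"
    obtain T where T: "T \<subseteq> {0<..<length ?D}" "T \<noteq> {}" "?D ! 0 + card T < length ?D"
      "\<And>v. v \<in> T \<Longrightarrow> ?D ! v < card T" "\<And>e. e \<in> E \<Longrightarrow> e \<inter> T \<noteq> {} \<Longrightarrow> e \<subseteq> T"
      by (rule disconnected_realization[OF E disconnected]) auto
    have G: "simple_graph {..<n} E"
      using E len unfolding realization_def by auto
    have deg: "degree E l = 1" if "l \<in> {3..<n}" for l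
      using E len leaf[of l] that unfolding realization_def by auto
    let ?F = "{e \<in> E. e \<subseteq> {..<3}}"
    have "{..<n} = {..<3} \<union> {3..<n}" "{..<3} \<inter> {3..<n} = {}"
      using n by auto
    then have split: "n = card ?F + card {e \<in> E. e \<inter> {3..<n} \<noteq> {}}"
      using card_core_edges[OF G, of "{..<3}" "{3..<n}"] card len by simp
    have all: "card {e :: nat set. e \<subseteq> {..<3} \<and> card e = 2} = 3"
      by (simp add: n_subsets numeral_eq_Suc)
    have "card {e \<in> E. e \<inter> {3..<n} \<noteq> {}} \<le> n - 3"
      using leaf_edges_le[of "{3..<n}" E] deg by simp
    then have "3 \<le> card ?F" using split n by linarith
    then have "?F = {e. e \<subseteq> {..<3} \<and> card e = 2}"
      using all G by (intro card_seteq) (auto simp: simple_graph_def)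
    then have "{0, 1} \<in> ?F" "{0, 2} \<in> ?F"
      by auto
    then have "1 \<notin> T" "2 \<notin> T"
      using T(1) T(5)[of "{0, 1}"] T(5)[of "{0, 2}"] by auto
    have TL: "T \<subseteq> {3..<n}"
    proof
      fix v assume "v \<in> T"
      then have "v \<noteq> 0" "v \<noteq> 1" "v \<noteq> 2" "v < n"
        using T(1) len \<open>1 \<notin> T\<close> \<open>2 \<notin> T\<close> by auto
      then show "v \<in> {3..<n}" by auto
    qed
    then obtain v where v: "v \<in> T" "v \<in> {3..<n}" using T(2) by blast
    then have "{e \<in> E. v \<in> e} \<noteq> {}"
      using deg[of v] by (force simp: degree_def)
    then obtain e where "e \<in> E" "v \<in> e" by auto
    then have "e \<in> E" "e \<subseteq> {3..<n}"
      using T(5)[of e] v TL by auto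
    then have "card {e \<in> E. e \<inter> {3..<n} \<noteq> {}} < n - 3"
      using leaf_edges_less[OF G, of "{3..<n}" e] deg by simp
    moreover have "card ?F \<le> 3"
      using card_core_edges_le[OF G, of "{..<3}"] by (simp add: numeral_eq_Suc)
    ultimately show False using split by linarith
  qed
qed simp

section \<open>The classification, by the number of big vertices\<close>

theorem theorem3p1:
  fixes D :: "nat list" and n :: nat
  assumes "length D = n"
    and "sorted_wrt (\<ge>) D"
  shows "forcibly_graphic unicyclic D \<longleftrightarrow>
      (D = replicate 5 2 \<or> D = [3] @ replicate 4 2 @ [1])
    \<or> (n \<ge> 4 \<and> D = [n - 2] @ replicate 3 2 @ replicate (n - 4) 1)
    \<or> (\<exists>r s t. n \<ge> 3 \<and> r \<ge> s \<and> s \<ge> t \<and> t \<ge> 2 \<and> r + s + t = n + 3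
          \<and> D = [r, s, t] @ replicate (n - 3) 1)"
    (is "_ \<longleftrightarrow> ?sporadic \<or> ?four \<or> ?three")
proof
  assume "?sporadic \<or> ?four \<or> ?three"
  then show "forcibly_graphic unicyclic D"
    using forcibly_unicyclic_two_five forcibly_unicyclic_three_two_four_one
      forcibly_unicyclic_four_cycle forcibly_unicyclic_triangle by blast
next
  assume forced: "forcibly_graphic unicyclic D"
  then obtain m where m: "3 \<le> m" "m \<le> n" and big: "\<And>i. i < m \<Longrightarrow> D ! i \<ge> 2"
    and leaf: "\<And>i. m \<le> i \<Longrightarrow> i < n \<Longrightarrow> D ! i = 1" and total: "(\<Sum>i<m. D ! i) = n + m"
    using forcibly_unicyclicE[OF forced assms(2)] assms(1) by blast
  have mono: "D ! j \<le> D ! i" if "i < j" "j < n" for i j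
    using sorted_wrt_nth_less[OF assms(2)] that assms(1) by simp
  have bicyclic: False
    if "simple_graph {..<m} F" "card F = Suc m" "\<And>i. i < m \<Longrightarrow> degree F i \<le> D ! i" for F
    using bicyclic_core_not_forcibly_unicyclic[of m F D] that forced m leaf total assms(1) by blast
  have "m < 6"
    using two_cycles_not_forcibly_unicyclic[of m D] forced m big leaf total assms(1)
    by (meson not_less)
  then consider "m = 3" | "m = 4" | "m = 5" using m by linarith
  then show "?sporadic \<or> ?four \<or> ?three"
  proof cases
    case 1
    have "D = [D ! 0, D ! 1, D ! 2] @ replicate (n - 3) 1"
    proof (rule nth_equalityI)
      fix i assume i: "i < length D"
      consider "i = 0" | "i = 1" | "i = 2" | "3 \<le> i" by linarith
      then show "D ! i = ([D ! 0, D ! 1, D ! 2] @ replicate (n - 3) 1) ! i"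
        using leaf[of i] i 1 assms(1) by cases (simp_all add: nth_append)
    qed (use m assms(1) in simp)
    moreover have "D ! 0 + D ! 1 + D ! 2 = n + 3"
      using total 1 by (simp add: numeral_eq_Suc)
    moreover have "D ! 0 \<ge> D ! 1" "D ! 1 \<ge> D ! 2" "D ! 2 \<ge> 2"
      using mono m 1 big by auto
    ultimately have ?three
      using m 1 by blast
    then show ?thesis by blast
  next
    case 2
    have low: "D ! 0 \<ge> D ! 1" "D ! 1 \<ge> 2" "D ! 2 \<ge> 2" "D ! 3 \<ge> 2" "D ! 1 \<ge> D ! 2" "D ! 2 \<ge> D ! 3"
      using mono m 2 big by auto
    \<comment> \<open>The core is the complete graph on four vertices without the edge
      \<open>{2, 3}\<close>: five edges, degrees 3, 3, 2, 2.\<close>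
    have "\<not> D ! 1 \<ge> 3"
    proof
      assume "D ! 1 \<ge> 3"
      then have deg: "degree {{0, 1}, {0, 2}, {2, 1}, {0, 3}, {3, 1}} i \<le> D ! i" if "i < 4" for i :: nat
      proof -
        have "i \<in> {0, 1, 2, 3}" using that by auto
        then show ?thesis
          using low \<open>D ! 1 \<ge> 3\<close> by (auto simp: degree_insert degree_empty doubleton_eq_iff)
      qed
      show False
        by (rule bicyclic[of "{{0, 1}, {0, 2}, {2, 1}, {0, 3}, {3, 1}}"])
          (use 2 deg in \<open>auto simp: simple_graph_def card_insert_if doubleton_eq_iff\<close>)
    qed
    then have vals: "D ! 1 = 2" "D ! 2 = 2" "D ! 3 = 2"
      using low by auto
    then have "D ! 0 = n - 2"
      using total 2 by (simp add: numeral_eq_Suc)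
    then have "D = [n - 2] @ replicate 3 2 @ replicate (n - 4) 1"
      using 2 m leaf assms(1) vals
      by (intro nth_equalityI) (auto simp: nth_Cons' nth_append numeral_eq_Suc less_Suc_eq_le not_less_eq_eq le_Suc_eq)
    then show ?thesis using m 2 by blast
  next
    case 3
    have low: "D ! 0 \<ge> D ! 1" "D ! 1 \<ge> 2" "D ! 2 \<ge> 2" "D ! 3 \<ge> 2" "D ! 4 \<ge> 2"
      "D ! 1 \<ge> D ! 2" "D ! 2 \<ge> D ! 3" "D ! 3 \<ge> D ! 4"
      using mono m 3 big by auto
    have cases5: "i \<in> {0, 1, 2, 3, 4}" if "i < 5" for i :: nat
      using that by auto
    \<comment> \<open>The core consists of three paths from 0 to 1, of lengths 1, 2 and 3: six
      edges, degrees 3, 3, 2, 2, 2.\<close>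
    have "\<not> D ! 1 \<ge> 3"
    proof
      assume "D ! 1 \<ge> 3"
      then have deg: "degree {{0, 1}, {0, 2}, {2, 1}, {0, 3}, {3, 4}, {4, 1}} i \<le> D ! i" if "i < 5" for i :: nat
        using low cases5[OF that] by (auto simp: degree_insert degree_empty doubleton_eq_iff)
      show False
        by (rule bicyclic[of "{{0, 1}, {0, 2}, {2, 1}, {0, 3}, {3, 4}, {4, 1}}"])
          (use 3 deg in \<open>auto simp: simple_graph_def card_insert_if doubleton_eq_iff\<close>)
    qed
    then have vals: "D ! 1 = 2" "D ! 2 = 2" "D ! 3 = 2" "D ! 4 = 2"
      using low by auto
    then have sum: "D ! 0 + 8 = n + 5"
      using total 3 by (simp add: numeral_eq_Suc)
    \<comment> \<open>The core is two triangles sharing vertex 0: six edges, degrees 4, 2, 2, 2,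
      2.\<close>
    have "\<not> D ! 0 \<ge> 4"
    proof
      assume "D ! 0 \<ge> 4"
      then have deg: "degree {{0, 1}, {1, 2}, {2, 0}, {0, 3}, {3, 4}, {4, 0}} i \<le> D ! i" if "i < 5" for i :: nat
        using low cases5[OF that] by (auto simp: degree_insert degree_empty doubleton_eq_iff)
      show False
        by (rule bicyclic[of "{{0, 1}, {1, 2}, {2, 0}, {0, 3}, {3, 4}, {4, 0}}"])
          (use 3 deg in \<open>auto simp: simple_graph_def card_insert_if doubleton_eq_iff\<close>)
    qed
    then consider "D ! 0 = 2" "n = 5" | "D ! 0 = 3" "n = 6"
      using low sum vals by linarith
    then have ?sporadic
    proof cases
      case 1
      then have "D = replicate 5 2"
        using assms(1) vals cases5 by (intro nth_equalityI) fastforce+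
      then show ?thesis by blast
    next
      case 2
      have "i \<in> {0, 1, 2, 3, 4, 5}" if "i < 6" for i :: nat
        using that by auto
      then have "D = [3] @ replicate 4 2 @ [1]"
        using assms(1) vals 2 leaf[of 5] 3 by (intro nth_equalityI) (fastforce simp: nth_append)+
      then show ?thesis by blast
    qed
    then show ?thesis by blast
  qed
qed

end
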